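(* Consider three-pursuer one-evader games in $\mathbb{R}^2$ in which all players have unit speed and the initial evader position lies strictly inside the convex hull of the initial pursuer positions. Let $M_{\mathcal{D}}$ be the game length when the pursuers play the decentralized $\mathcal{D}$-strategy and the evader plays optimally against it, and let $M_{\mathcal{C}}$ be the optimal game length in the cooperative pursuers' setting (both defined in the context). Then there exist games such that $$M_{\mathcal{C}}=M_{\mathcal{D}}.$$
   Context: **Game.** $E(t)\in\mathbb{R}^2$ and $P_i(t)\in\mathbb{R}^2$, $i=1,2,3$, are the evader and pursuer positions, with $\dot E(t)=e(t)$, $\dot P_i(t)=w_i(t)$, $\|e(t)\|=\|w_i(t)\|=1$; players can move in any direction in the whole plane. A game is specified by its initial condition $E(0),P_1(0),P_2(0),P_3(0)$. Capture occurs at the first time $t$ with $P_i(t)=E(t)$ for some $i$; the game length is the capture time. The evader knows the full state of the game. **Voronoi cell.** $\mathcal{V}(t)$ is the set of points of the plane closer to $E(t)$ than to every $P_i(t)$. Under the assumptions, $\mathcal{V}(0)$ is a triangle. Its vertices are named $V_1(0),V_2(0),V_3(0)$ so that $V_1(0)$ is the vertex joining the longest and the medium edges and $\|V_1(0)-V_2(0)\|$ is the length of the longest edge. **Decentralized length $M_{\mathcal{D}}$.** Let $\mathcal{L}(V,v)=\{V+\alpha v:\alpha\in\mathbb{R}\}$ and $v=V_1(0)-V_2(0)$. Put $S=\overline{V_2(0)V_3(0)}\cap\mathcal{L}(E(0),v)$, $Q=\overline{V_1(0)V_3(0)}\cap\mathcal{L}(E(0),v)$ and $M_{\mathcal{D}}=\|S-Q\|+\|Q-V_1(0)\|$.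 This is the length of the game when the evader plays optimally (surviving for the longest time) against the following decentralized pursuers' strategy ($\mathcal{D}$-strategy): with $C_i(t)=(P_i(t)+E(t))/2$, $z_i(t)=P_i(t)-E(t)$, $z_i(t)^\perp\neq0$ orthogonal to $z_i(t)$, and $B_i(t)=\mathcal{L}(E(t),e(t))\cap\mathcal{L}(C_i(t),z_i(t)^\perp)$, pursuer $i$ plays $w_i(t)=e(t)$ if $z_i(t)'e(t)\le0$ and $w_i(t)=(B_i(t)-P_i(t))/\|B_i(t)-P_i(t)\|$ if $z_i(t)'e(t)>0$ (the prime denotes transpose). **Cooperative length $M_{\mathcal{C}}$.** In a cooperative pursuers' strategy each pursuer knows the full game state and chooses $w_i(t)$ depending on $P_1(t),P_2(t),P_3(t),E(t)$ and $e(t)$. A pursuers' strategy is optimal when it guarantees capture in minimum time. $M_{\mathcal{C}}$ is the maximum capture time under the optimal cooperative pursuers' strategy, i.e. the time at which capture occurs if the evader plays at its best. **Limit convention.** When the evader is said to move to a point on the boundary of the Voronoi cell, it moves to an interior point of the cell at distance less than $\delta$ from it, for a small $\delta>0$; all results are understood as limit results obtained by letting $\delta$ tend to $0$.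
   Formalization: Exact equality fails for every game with the evader strictly inside, so it is read as a limit: for a fixed triangular Voronoi cell, as the initial evader position tends to a boundary point of it, M_C and M_D (and the closed form of M_D) converge to the same positive finite value. *)

theory Defs
  imports "HOL-Analysis.Analysis"
begin

text \<open>
  A state is the evader position together with the three pursuer positions.
  A game is given by its initial state.
\<close>

type_synonym plane = "real ^ 2"
type_synonym state = "plane \<times> (3 \<Rightarrow> plane)"

definition three_pursuer_game :: "state \<Rightarrow> bool" where
  "three_pursuer_game g \<longleftrightarrow> fst g \<in> interior (convex hull (range (snd g)))"

definition voronoi_cell :: "state \<Rightarrow> plane set" where
  "voronoi_cell g = {x. \<forall>i. dist x (fst g) < dist x (snd g i)}"

definition captured :: "state \<Rightarrow> bool" where
  "captured s \<longleftrightarrow> (\<exists>i. snd s i = fst s)"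

text \<open>
  A pursuers' strategy maps the current state and the current evader velocity to the three
  pursuer velocities.
\<close>

type_synonym strategy = "state \<Rightarrow> plane \<Rightarrow> 3 \<Rightarrow> plane"

definition evader_control :: "(real \<Rightarrow> plane) \<Rightarrow> bool" where
  "evader_control e \<longleftrightarrow> e \<in> borel_measurable borel \<and> (\<forall>t. norm (e t) = 1)"

text \<open>
  The equations of motion are read in the Caratheodory (integrated) sense, since neither the
  evader velocity nor a strategy need be continuous; the case \<open>t = 0\<close> is the initial condition.
  What happens after the capture time has no influence on \<open>capture_time\<close> below.
\<close>

definition play :: "strategy \<Rightarrow> state \<Rightarrow> (real \<Rightarrow> plane) \<Rightarrow> (real \<Rightarrow> state) \<Rightarrow> bool" where
  "play \<sigma> g e x \<longleftrightarrow> evader_control e \<and>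
     (\<forall>t\<ge>0. (e has_integral (fst (x t) - fst g)) {0..t} \<and>
       (\<forall>i. ((\<lambda>s. \<sigma> (x s) (e s) i) has_integral (snd (x t) i - snd g i)) {0..t}))"

text \<open>
  The existence requirement excludes discontinuous feedbacks that admit no motion at all, for
  which a supremum over plays would be vacuous.
\<close>

definition admissible :: "strategy \<Rightarrow> state \<Rightarrow> bool" where
  "admissible \<sigma> g \<longleftrightarrow>
     (\<forall>s u i. norm u = 1 \<longrightarrow> norm (\<sigma> s u i) = 1) \<and>
     (\<forall>e. evader_control e \<longrightarrow> (\<exists>x. play \<sigma> g e x))"

text \<open>The value is \<open>\<infinity>\<close> if capture never occurs.\<close>

definition capture_time :: "(real \<Rightarrow> state) \<Rightarrow> ennreal" where
  "capture_time x = Inf (ennreal ` {t. 0 \<le> t \<and> captured (x t)})"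

text \<open>
  Game length when the evader plays at its best against \<open>\<sigma>\<close>. Against a fixed pursuers' strategy,
  an evader that observes the state generates some velocity function of time, so it is enough
  to take the supremum over these.
\<close>

definition game_length :: "strategy \<Rightarrow> state \<Rightarrow> ennreal" where
  "game_length \<sigma> g = (SUP (e, x) \<in> {(e, x). play \<sigma> g e x}. capture_time x)"

definition M_C :: "state \<Rightarrow> ennreal" where
  "M_C g = (INF \<sigma> \<in> {\<sigma>. admissible \<sigma> g}. game_length \<sigma> g)"

definition line_dir :: "plane \<Rightarrow> plane \<Rightarrow> plane set" where
  "line_dir V v = {V + \<alpha> *\<^sub>R v | \<alpha>. True}"

definition perp :: "plane \<Rightarrow> plane" where
  "perp z = vector [- (z $ 2), z $ 1]"

text \<open>If \<open>z \<bullet> e > 0\<close>, the two lines below meet in exactly one point \<open>B\<close>, and \<open>B\<close> differs from the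
  pursuer position.\<close>

definition D_strategy :: strategy where
  "D_strategy s e i =
     (let E = fst s; P = snd s i; z = P - E; C = (1/2) *\<^sub>R (P + E);
          B = the_elem (line_dir E e \<inter> line_dir C (perp z))
      in if z \<bullet> e \<le> 0 then e else (1 / norm (B - P)) *\<^sub>R (B - P))"

definition M_D :: "state \<Rightarrow> ennreal" where
  "M_D g = game_length D_strategy g"

definition labelled_triangle :: "plane \<Rightarrow> plane \<Rightarrow> plane \<Rightarrow> bool" where
  "labelled_triangle V1 V2 V3 \<longleftrightarrow> \<not> collinear {V1, V2, V3} \<and>
     dist V2 V3 \<le> dist V1 V3 \<and> dist V1 V3 \<le> dist V1 V2"

text \<open>
  The closed form of the decentralized length for a game with evader position \<open>E\<close> whose Voronoi
  cell has the labelled vertices \<open>V1\<close>, \<open>V2\<close>, \<open>V3\<close>.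
\<close>

definition D_formula :: "plane \<Rightarrow> plane \<Rightarrow> plane \<Rightarrow> plane \<Rightarrow> real" where
  "D_formula V1 V2 V3 E =
     (let v = V1 - V2;
          S = the_elem (closed_segment V2 V3 \<inter> line_dir E v);
          Q = the_elem (closed_segment V1 V3 \<inter> line_dir E v)
      in norm (S - Q) + norm (Q - V1))"

text \<open>
  Limit convention: placing the evader at a boundary point \<open>X\<close> of the Voronoi cell means placing it
  at an interior point of that cell at distance less than \<open>\<delta>\<close> from \<open>X\<close>, and letting \<open>\<delta>\<close> tend to 0.
  The filter consists of the games with the prescribed Voronoi cell, as the evader position
  tends to \<open>X\<close>.
\<close>

definition games_near :: "plane \<Rightarrow> plane \<Rightarrow> plane \<Rightarrow> plane \<Rightarrow> state filter" where
  "games_near V1 V2 V3 X =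
     (INF \<delta> \<in> {0<..}. principal {g. three_pursuer_game g \<and>
        voronoi_cell g = interior (convex hull {V1, V2, V3}) \<and> dist (fst g) X < \<delta>})"

end

theory Submission
  imports Defs
begin

text \<open>
  Take the right isosceles triangle with legs of length 1 and let the evader start near an end
  \<open>V\<^sub>1\<close> of the hypotenuse. Running straight to a point of its Voronoi cell, the evader cannot be
  intercepted whatever the pursuers do, so every admissible strategy needs at least the time
  \<open>dist E V\<^sub>2\<close>, which tends to \<open>sqrt 2\<close>. Conversely, under the decentralized strategy the edges of
  the cell keep their directions, and the distance to the edge with unit outer normal \<open>n\<close>
  decreases at rate \<open>max 0 (n \<bullet> e)\<close>. Weighted with the edge lengths, these distances sum to twice the area
  initially, and the sum decreases at a rate of at least the smallest height of the triangle.
  Hence capture occurs within the length of the longest edge, \<open>sqrt 2\<close>, and both game lengths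
  are squeezed.
\<close>

section \<open>Integration on real intervals\<close>

lemma borel_bounded_integrable_on:
  fixes f :: "real \<Rightarrow> 'a::euclidean_space"
  assumes "f \<in> borel_measurable borel" and "\<And>s. norm (f s) \<le> B"
  shows "f integrable_on {a..b}"
proof (rule measurable_bounded_by_integrable_imp_integrable[where g = "\<lambda>_. B"])
  show "f \<in> borel_measurable (lebesgue_on {a..b})"
    using assms(1) by (intro measurable_restrict_space1 measurable_completion) simp
qed (use assms(2) in auto)

text \<open>Uniqueness for a linear equation with a bounded, possibly discontinuous coefficient. The
  weight \<open>exp (- 2 * K * s)\<close> makes the integral a contraction: at the maximiser
  \<open>t0\<close> of the weighted modulus, integration bounds \<open>\<bar>y t0\<bar>\<close> by
  less than half of itself unless the maximum \<open>m\<close> is 0.\<close>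

lemma linear_integral_equation_zero:
  fixes y c :: "real \<Rightarrow> real"
  assumes cont: "continuous_on {0..T} y"
    and eq: "\<And>t. t \<in> {0..T} \<Longrightarrow> ((\<lambda>s. c s * y s) has_integral y t) {0..t}"
    and K: "0 < K" "\<And>s. s \<in> {0..T} \<Longrightarrow> \<bar>c s\<bar> \<le> K"
    and t: "t \<in> {0..T}"
  shows "y t = 0"
proof -
  have "continuous_on {0..T} (\<lambda>s. exp (- 2 * K * s) * \<bar>y s\<bar>)"
    by (intro continuous_intros cont)
  then obtain t0 where t0: "t0 \<in> {0..T}"
    and sup: "\<And>s. s \<in> {0..T} \<Longrightarrow> exp (- 2 * K * s) * \<bar>y s\<bar> \<le> exp (- 2 * K * t0) * \<bar>y t0\<bar>"
    using continuous_attains_sup[of "{0..T}" "\<lambda>s. exp (- 2 * K * s) * \<bar>y s\<bar>"] t by auto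
  define m where "m = exp (- 2 * K * t0) * \<bar>y t0\<bar>"
  have bd: "\<bar>y s\<bar> \<le> m * exp (2 * K * s)" if "s \<in> {0..T}" for s
    using sup[OF that] by (simp add: m_def exp_minus field_simps)
  have hi: "((\<lambda>s. K * m * exp (2 * K * s)) has_integral
      m / 2 * exp (2 * K * t0) - m / 2 * exp (2 * K * 0)) {0..t0}"
    using t0 K(1)
    by (intro fundamental_theorem_of_calculus)
       (auto intro!: derivative_eq_intros simp flip: has_real_derivative_iff_has_vector_derivative)
  have "norm (integral {0..t0} (\<lambda>s. c s * y s)) \<le> integral {0..t0} (\<lambda>s. K * m * exp (2 * K * s))"
  proof (rule integral_norm_bound_integral)
    show "norm (c s * y s) \<le> K * m * exp (2 * K * s)" if "s \<in> {0..t0}" for s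
    proof -
      have "\<bar>c s\<bar> * \<bar>y s\<bar> \<le> K * (m * exp (2 * K * s))"
        using that t0 by (intro mult_mono K bd) (use K in auto)
      then show ?thesis by (simp add: abs_mult mult.assoc)
    qed
  qed (use eq[OF t0] hi in auto)
  then have "\<bar>y t0\<bar> \<le> m / 2 * exp (2 * K * t0) - m / 2"
    using integral_unique[OF eq[OF t0]] integral_unique[OF hi] by simp
  moreover have "\<bar>y t0\<bar> = m * exp (2 * K * t0)"
    by (simp add: m_def mult.assoc mult.commute flip: exp_add)
  moreover have "0 \<le> m" by (simp add: m_def)
  moreover from this have "0 \<le> m * exp (2 * K * t0)" by simp
  ultimately have "m = 0" by linarith
  then show ?thesis using bd[OF t] by simp
qed

text \<open>Used for the explicit motions, where shrinking at rate \<open>k\<close> is switched off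
  once a total of 1 is used up. The indefinite integral is continuous and monotone, so the cut
  happens at the first time when it equals 1.\<close>

lemma has_integral_stopped:
  fixes k :: "real \<Rightarrow> real"
  assumes int: "\<And>b. k integrable_on {0..b}" and nn: "\<And>s. 0 \<le> k s" and t: "0 \<le> t"
  shows "((\<lambda>s. if integral {0..s} k < 1 then k s else 0) has_integral
           min 1 (integral {0..t} k)) {0..t}"
proof -
  let ?K = "\<lambda>s. integral {0..s} k"
  let ?f = "\<lambda>s. if ?K s < 1 then k s else 0"
  have mono: "?K a \<le> ?K b" if "a \<le> b" for a b
    by (rule integral_subset_le) (use that int nn in auto)
  show ?thesis
  proof (cases "?K t < 1")
    case True
    then have "\<And>s. s \<in> {0..t} \<Longrightarrow> k s = ?f s" using mono[of _ t] by fastforce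
    from has_integral_eq[OF this integrable_integral[OF int]] show ?thesis using True by simp
  next
    case False
    have cont: "continuous_on {0..t} ?K"
      using int by (rule indefinite_integral_continuous_1)
    let ?S = "{s \<in> {0..t}. ?K s = 1}"
    have "bounded ?S" by (rule bounded_subset[of "{0..t}"]) auto
    then have "compact ?S"
      using continuous_closed_preimage_constant[OF cont, of 1] by (simp add: compact_eq_bounded_closed)
    moreover have "?S \<noteq> {}"
      using IVT'[of ?K 0 1 t] cont t False by auto
    ultimately obtain \<tau> where \<tau>: "\<tau> \<in> ?S" and least: "\<And>s. s \<in> ?S \<Longrightarrow> \<tau> \<le> s"
      using compact_attains_inf by meson
    have "(?f has_integral 1) {0..\<tau>}"
    \<comment> \<open>On \<open>{0..\<tau>}\<close> the two integrands can differ only at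
      \<open>\<tau>\<close>, where the stopped one is already 0.\<close>
    proof (rule has_integral_spike_finite[of "{\<tau>}"])
      show "(k has_integral 1) {0..\<tau>}" using \<tau> integrable_integral[OF int, of \<tau>] by simp
      show "?f s = k s" if "s \<in> {0..\<tau>} - {\<tau>}" for s
      proof -
        from that \<tau> have s: "s \<in> {0..t}" "s < \<tau>" by auto
        then have "?K s \<noteq> 1" using least[of s] by auto
        with mono[of s \<tau>] s \<tau> show ?thesis by auto
      qed
    qed simp
    moreover have "(?f has_integral 0) {\<tau>..t}"
      by (rule has_integral_is_0) (use mono \<tau> in fastforce)
    ultimately have "(?f has_integral 1 + 0) {0..t}"
      using \<tau> by (intro has_integral_combine[where c = \<tau>]) auto
    then show ?thesis using False by simp
  qed
qed

section \<open>Motions under the decentralized strategy\<close>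

lemma inner_plane: "x \<bullet> y = x $ 1 * y $ 1 + x $ 2 * y $ 2" for x y :: plane
  by (simp add: inner_vec_def sum_2)

lemma plane_eq_iff: "x = y \<longleftrightarrow> x $ 1 = y $ 1 \<and> x $ 2 = y $ 2" for x y :: plane
  by (simp add: vec_eq_iff forall_2)

lemma norm_plane: "norm x = sqrt ((x $ 1)\<^sup>2 + (x $ 2)\<^sup>2)" for x :: plane
  by (simp add: norm_eq_sqrt_inner inner_plane power2_eq_square)

lemma perp_nth [simp]: "perp z $ 1 = - (z $ 2)" "perp z $ 2 = z $ 1"
  by (simp_all add: perp_def)

text \<open>The pursuer mirrors an approaching evader in their bisector, so that the offset
  \<open>P - E\<close> only shrinks along itself. For a vanishing offset the quotient is \<open>0/0 = 0\<close>, in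
  agreement with the strategy.\<close>

lemma D_strategy_eq:
  fixes s :: state and u :: plane and i :: 3
  assumes u: "norm u = 1"
  defines "z \<equiv> snd s i - fst s"
  shows "D_strategy s u i = u - (2 * max 0 (z \<bullet> u) / (z \<bullet> z)) *\<^sub>R z"
proof (cases "z \<bullet> u \<le> 0")
  case True
  then show ?thesis by (simp add: D_strategy_def Let_def z_def)
next
  case False
  define E where "E = fst s"
  define P where "P = snd s i"
  \<comment> \<open>Distance along \<open>u\<close> from \<open>E\<close> to the bisector of
    \<open>E\<close> and \<open>P\<close>.\<close>
  define \<alpha> where "\<alpha> = (z \<bullet> z) / (2 * (z \<bullet> u))"
  have z: "z = P - E" by (simp add: z_def E_def P_def)
  from False have pos: "0 < z \<bullet> u" "0 < z \<bullet> z" by auto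
  then have \<alpha>: "0 < \<alpha>" "\<alpha> * (z \<bullet> u) = (z \<bullet> z) / 2" by (auto simp: \<alpha>_def)
  have "line_dir E u \<inter> line_dir ((1/2) *\<^sub>R (P + E)) (perp z) = {E + \<alpha> *\<^sub>R u}"
  proof (intro equalityI subsetI)
    fix B assume "B \<in> line_dir E u \<inter> line_dir ((1/2) *\<^sub>R (P + E)) (perp z)"
    then obtain a b where B: "B = E + a *\<^sub>R u" "B = (1/2) *\<^sub>R (P + E) + b *\<^sub>R perp z"
      unfolding line_dir_def by blast
    have "z \<bullet> perp z = 0" by (simp add: inner_plane)
    moreover have "a *\<^sub>R u = (1/2) *\<^sub>R z + b *\<^sub>R perp z"
      using B unfolding z by (simp add: plane_eq_iff field_simps)
    then have "z \<bullet> (a *\<^sub>R u) = z \<bullet> ((1/2) *\<^sub>R z + b *\<^sub>R perp z)" by simp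
    ultimately have "a * (z \<bullet> u) = (z \<bullet> z) / 2" by (simp add: inner_add_right)
    then have "a = \<alpha>" using \<alpha>(2) pos by (metis less_irrefl mult_right_cancel)
    then show "B \<in> {E + \<alpha> *\<^sub>R u}" using B by simp
  next
    fix B assume "B \<in> {E + \<alpha> *\<^sub>R u}"
    then have B: "B = E + \<alpha> *\<^sub>R u" by simp
    \<comment> \<open>The vector from the midpoint of \<open>E\<close> and \<open>P\<close> to
      \<open>B\<close>. In the plane, orthogonality to \<open>z\<close> makes it a multiple of
      \<open>perp z\<close>.\<close>
    define q where "q = \<alpha> *\<^sub>R u - (1/2) *\<^sub>R z"
    have "z \<bullet> q = 0" using \<alpha>(2) by (simp add: q_def inner_diff_right)
    then have eq: "z $ 1 * q $ 1 = - (z $ 2 * q $ 2)" by (simp add: inner_plane)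
    define b where "b = (q \<bullet> perp z) / (z \<bullet> z)"
    have "(z \<bullet> z) *\<^sub>R q = (q \<bullet> perp z) *\<^sub>R perp z"
      using eq unfolding plane_eq_iff inner_plane by simp algebra
    then have "(1 / (z \<bullet> z)) *\<^sub>R ((z \<bullet> z) *\<^sub>R q) = b *\<^sub>R perp z" by (simp add: b_def)
    then have "q = b *\<^sub>R perp z" using pos(2) by simp
    then have "B = (1/2) *\<^sub>R (P + E) + b *\<^sub>R perp z"
      using B unfolding q_def z by (simp add: plane_eq_iff field_simps)
    then show "B \<in> line_dir E u \<inter> line_dir ((1/2) *\<^sub>R (P + E)) (perp z)"
      using B unfolding line_dir_def by blast
  qed
  then have "the_elem (line_dir E u \<inter> line_dir ((1/2) *\<^sub>R (P + E)) (perp z)) - P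
      = \<alpha> *\<^sub>R u - z" (is "?B - P = _")
    by (simp add: z)
  \<comment> \<open>\<open>B\<close> lies on the bisector, hence is as far from \<open>P\<close> as
    from \<open>E\<close>.\<close>
  moreover have "norm (\<alpha> *\<^sub>R u - z) = \<alpha>"
  proof -
    have "(\<alpha> *\<^sub>R u - z) \<bullet> (\<alpha> *\<^sub>R u - z) = \<alpha>\<^sup>2 * (u \<bullet> u) - 2 * (\<alpha> * (z \<bullet> u)) + z \<bullet> z"
      by (simp add: inner_diff_left inner_diff_right inner_commute power2_eq_square algebra_simps)
    also have "\<dots> = \<alpha>\<^sup>2" using u \<alpha>(2) by (simp add: norm_eq_1)
    finally show ?thesis using \<alpha>(1) by (simp add: norm_eq_sqrt_inner)
  qed
  ultimately have "(1 / norm (?B - P)) *\<^sub>R (?B - P) = (1 / \<alpha>) *\<^sub>R (\<alpha> *\<^sub>R u - z)"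
    by simp
  moreover have "D_strategy s u i = (1 / norm (?B - P)) *\<^sub>R (?B - P)"
    using False by (simp add: D_strategy_def Let_def z_def E_def P_def)
  ultimately have "D_strategy s u i = (1 / \<alpha>) *\<^sub>R (\<alpha> *\<^sub>R u - z)" by simp
  also have "\<dots> = u - (1 / \<alpha>) *\<^sub>R z"
    using \<alpha>(1) by (simp add: scaleR_diff_right)
  also have "1 / \<alpha> = 2 * max 0 (z \<bullet> u) / (z \<bullet> z)"
    using pos by (simp add: \<alpha>_def)
  finally show ?thesis .
qed

text \<open>For an approaching evader the velocity is \<open>u\<close> reflected in the line
  orthogonal to the offset; otherwise it is \<open>u\<close> itself.\<close>

lemma norm_D_strategy:
  assumes "norm u = 1"
  shows "norm (D_strategy s u i) = 1"
proof -
  define z where "z = snd s i - fst s"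
  define k where "k = 2 * max 0 (z \<bullet> u) / (z \<bullet> z)"
  have "k * k * (z \<bullet> z) = 2 * k * (z \<bullet> u)"
    by (cases "z = 0") (auto simp: k_def max_def)
  then have "(u - k *\<^sub>R z) \<bullet> (u - k *\<^sub>R z) = u \<bullet> u"
    by (simp add: inner_diff_left inner_diff_right inner_commute algebra_simps)
  then show ?thesis
    using assms by (simp add: D_strategy_eq[OF assms] z_def k_def norm_eq_sqrt_inner)
qed

lemma norm_evader: "evader_control e \<Longrightarrow> norm (e s) = 1"
  by (simp add: evader_control_def)

lemma evader_integrable_on: "evader_control e \<Longrightarrow> e integrable_on {a..b}"
  by (rule borel_bounded_integrable_on[where B = 1]) (auto simp: evader_control_def)

lemma approach_integrable_on:
  assumes "evader_control e"
  shows "(\<lambda>s. 2 * max 0 (z \<bullet> e s) / (z \<bullet> z)) integrable_on {a..b}"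
proof (rule borel_bounded_integrable_on)
  have [measurable]: "e \<in> borel_measurable borel"
    using assms by (simp add: evader_control_def)
  show "(\<lambda>s. 2 * max 0 (z \<bullet> e s) / (z \<bullet> z)) \<in> borel_measurable borel"
    by measurable
  fix s
  have "max 0 (z \<bullet> e s) \<le> norm z"
    using norm_cauchy_schwarz[of z "e s"] norm_evader[OF assms, of s] by simp
  then have "2 * max 0 (z \<bullet> e s) / (z \<bullet> z) \<le> 2 * norm z / (z \<bullet> z)"
    by (intro divide_right_mono) auto
  then show "norm (2 * max 0 (z \<bullet> e s) / (z \<bullet> z)) \<le> 2 * norm z / (z \<bullet> z)"
    by simp
qed

text \<open>The motion scales each initial offset \<open>P\<^sub>i(0) - E(0)\<close> by a factor that decreases at a
  rate not depending on the state, until it vanishes.\<close>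

lemma D_play_exists:
  assumes e: "evader_control e"
  shows "\<exists>x. play D_strategy g e x"
proof -
  define z where "z i = snd g i - fst g" for i
  define k where "k i s = 2 * max 0 (z i \<bullet> e s) / (z i \<bullet> z i)" for i s
  \<comment> \<open>The fraction of the initial offset that remains; \<open>min 1\<close> keeps it
    at 0 once it has vanished.\<close>
  define r where "r i t = 1 - min 1 (integral {0..t} (k i))" for i t
  define E where "E t = fst g + integral {0..t} e" for t
  define x where "x t = (E t, \<lambda>i. E t + r i t *\<^sub>R z i)" for t
  have ki: "k i integrable_on {a..b}" for i a b
    unfolding k_def using e by (rule approach_integrable_on)
  have kn: "0 \<le> k i s" for i s by (simp add: k_def)
  \<comment> \<open>The correction to the evader velocity is unchanged when the offset is scaled by
    a positive factor, so it can be computed from the initial offset until \<open>r\<close>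
    vanishes.\<close>
  have D: "D_strategy (x s) (e s) i = e s - (if integral {0..s} (k i) < 1 then k i s else 0) *\<^sub>R z i"
    for s i
  proof (cases "integral {0..s} (k i) < 1")
    case True
    then have "0 < r i s" by (simp add: r_def)
    moreover from this have "max 0 (r i s * (z i \<bullet> e s)) = r i s * max 0 (z i \<bullet> e s)"
      by (simp add: max_mult_distrib_left)
    ultimately show ?thesis
      using True by (simp add: D_strategy_eq[OF norm_evader[OF e]] x_def k_def)
  next
    case False
    then have "r i s = 0" by (simp add: r_def)
    then show ?thesis
      using False by (simp add: D_strategy_eq[OF norm_evader[OF e]] x_def)
  qed
  have "play D_strategy g e x"
    unfolding play_def
  proof (intro conjI allI impI)
    fix t :: real and i assume t: "0 \<le> t"
    have E: "(e has_integral (E t - fst g)) {0..t}"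
      using integrable_integral[OF evader_integrable_on[OF e]] by (simp add: E_def)
    then show "(e has_integral (fst (x t) - fst g)) {0..t}" by (simp add: x_def)
    have "((\<lambda>s. D_strategy (x s) (e s) i) has_integral
        (E t - fst g) - min 1 (integral {0..t} (k i)) *\<^sub>R z i) {0..t}"
      unfolding D
      by (intro has_integral_diff E has_integral_scaleR_left has_integral_stopped ki kn t)
    also have "(E t - fst g) - min 1 (integral {0..t} (k i)) *\<^sub>R z i = snd (x t) i - snd g i"
      by (simp add: x_def r_def z_def algebra_simps)
    finally show "((\<lambda>s. D_strategy (x s) (e s) i) has_integral (snd (x t) i - snd g i)) {0..t}" .
  qed (fact e)
  then show ?thesis by blast
qed

lemma admissible_D_strategy: "admissible D_strategy g"
  by (simp add: admissible_def norm_D_strategy D_play_exists)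

text \<open>Every motion, not only the one constructed above, shrinks the offset along itself until
  the pursuer meets the evader; \<open>r\<close> is the remaining fraction. The component orthogonal
  to \<open>z0\<close> solves a linear equation with initial value 0, so it vanishes. The factor
  starts at 1 and is continuous, and a zero of it would be a meeting; being positive, it cancels
  from the rate.\<close>

lemma D_play_offset:
  assumes play: "play D_strategy g e x"
    and free: "\<And>t. t \<in> {0..T} \<Longrightarrow> snd (x t) i \<noteq> fst (x t)"
    and t: "t \<in> {0..T}"
  defines "z0 \<equiv> snd g i - fst g"
  shows "\<exists>r>0. ((\<lambda>s. 2 * max 0 (z0 \<bullet> e s) / (z0 \<bullet> z0)) has_integral 1 - r) {0..t}"
proof -
  define z where "z t = snd (x t) i - fst (x t)" for t
  define f where "f s = 2 * max 0 (z s \<bullet> e s) / (z s \<bullet> z s)" for s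
  from play have e: "evader_control e" by (simp add: play_def)
  have zint: "((\<lambda>s. - f s *\<^sub>R z s) has_integral z t - z0) {0..t}" if "0 \<le> t" for t
  proof -
    from play that have "((\<lambda>s. D_strategy (x s) (e s) i - e s) has_integral
        (snd (x t) i - snd g i) - (fst (x t) - fst g)) {0..t}"
      unfolding play_def by (intro has_integral_diff) auto
    then show ?thesis
      by (simp add: D_strategy_eq[OF norm_evader[OF e]] f_def z_def z0_def algebra_simps)
  qed
  have z_init: "z 0 = z0" using has_integral_unique[OF zint[of 0]] by fastforce
  have zne: "z s \<noteq> 0" if "s \<in> {0..T}" for s using free[OF that] by (simp add: z_def)
  have z0: "z0 \<noteq> 0" using zne[of 0] t z_init by auto
  have "continuous_on {0..T} (\<lambda>t. z0 + integral {0..t} (\<lambda>s. - f s *\<^sub>R z s))"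
    using zint[of T] t by (intro continuous_intros indefinite_integral_continuous_1) auto
  then have cont: "continuous_on {0..T} z"
    by (rule continuous_on_eq) (use integral_unique[OF zint] in auto)
  \<comment> \<open>By compactness the offset stays away from 0, which bounds the coefficient
    \<open>f\<close>.\<close>
  have "continuous_on {0..T} (\<lambda>s. norm (z s))" by (intro continuous_intros cont)
  then obtain t1 where t1: "t1 \<in> {0..T}" and least: "\<And>s. s \<in> {0..T} \<Longrightarrow> norm (z t1) \<le> norm (z s)"
    using continuous_attains_inf[of "{0..T}" "\<lambda>s. norm (z s)"] t by auto
  have fb: "\<bar>- f s\<bar> \<le> 2 / norm (z t1)" if s: "s \<in> {0..T}" for s
  proof -
    have "max 0 (z s \<bullet> e s) \<le> norm (z s)"
      using norm_cauchy_schwarz[of "z s" "e s"] norm_evader[OF e, of s] by simp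
    then have "f s \<le> 2 * norm (z s) / (z s \<bullet> z s)"
      unfolding f_def by (intro divide_right_mono) auto
    also have "\<dots> = 2 / norm (z s)"
      using zne[OF s] by (simp add: dot_square_norm power2_eq_square)
    also have "\<dots> \<le> 2 / norm (z t1)"
      using least[OF s] zne[OF t1] by (intro divide_left_mono) (auto intro!: mult_pos_pos zne[OF s])
    finally show ?thesis by (simp add: f_def)
  qed
  have orth: "z s \<bullet> perp z0 = 0" if s: "s \<in> {0..T}" for s
  proof (rule linear_integral_equation_zero[where c = "\<lambda>s. - f s", OF _ _ _ fb s])
    show "continuous_on {0..T} (\<lambda>s. z s \<bullet> perp z0)" by (intro continuous_intros cont)
    show "0 < 2 / norm (z t1)" using zne[OF t1] by simp
    fix t assume "t \<in> {0..T}"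
    then have "((\<lambda>s. (- f s *\<^sub>R z s) \<bullet> perp z0) has_integral (z t - z0) \<bullet> perp z0) {0..t}"
      using has_integral_linear[OF zint bounded_linear_inner_left] by (auto simp: o_def)
    moreover have "z0 \<bullet> perp z0 = 0" by (simp add: inner_plane)
    ultimately show "((\<lambda>s. - f s * (z s \<bullet> perp z0)) has_integral z t \<bullet> perp z0) {0..t}"
      by (simp add: inner_diff_left)
  qed
  define r where "r s = (z s \<bullet> z0) / (z0 \<bullet> z0)" for s
  have zr: "z s = r s *\<^sub>R z0" if s: "s \<in> {0..T}" for s
  proof -
    have "(z0 \<bullet> z0) *\<^sub>R z s = (z s \<bullet> z0) *\<^sub>R z0"
      using orth[OF s] unfolding plane_eq_iff inner_plane by simp algebra
    then have "(1 / (z0 \<bullet> z0)) *\<^sub>R ((z0 \<bullet> z0) *\<^sub>R z s) = r s *\<^sub>R z0" by (simp add: r_def)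
    then show ?thesis using z0 by simp
  qed
  have rcont: "continuous_on {0..T} r" unfolding r_def by (intro continuous_intros cont) (use z0 in auto)
  have rpos: "0 < r s" if s: "s \<in> {0..T}" for s
  proof (rule ccontr)
    assume "\<not> 0 < r s"
    moreover have "r 0 = 1" using z0 by (simp add: r_def z_init)
    moreover have "continuous_on {0..s} r" using rcont s by (auto intro: continuous_on_subset)
    ultimately obtain u where "u \<in> {0..s}" "r u = 0"
      using IVT2'[of r s 0 0] s by auto
    with zr[of u] zne[of u] s show False by auto
  qed
  have "((\<lambda>s. ((- f s *\<^sub>R z s) \<bullet> z0) / (z0 \<bullet> z0)) has_integral (z t - z0) \<bullet> z0 / (z0 \<bullet> z0)) {0..t}"
    using has_integral_linear[OF zint bounded_linear_inner_left, of t z0] t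
    by (intro has_integral_divide) (auto simp: o_def)
  from has_integral_neg[OF this]
  have "((\<lambda>s. f s * r s) has_integral 1 - r t) {0..t}"
    using z0 by (simp add: r_def inner_diff_left diff_divide_distrib)
  moreover have "f s * r s = 2 * max 0 (z0 \<bullet> e s) / (z0 \<bullet> z0)" if "s \<in> {0..t}" for s
  proof -
    from that t have s: "s \<in> {0..T}" by auto
    have "max 0 (r s * (z0 \<bullet> e s)) = r s * max 0 (z0 \<bullet> e s)"
      using rpos[OF s] by (simp add: max_mult_distrib_left)
    then show ?thesis using rpos[OF s] by (simp add: f_def zr[OF s])
  qed
  ultimately have "((\<lambda>s. 2 * max 0 (z0 \<bullet> e s) / (z0 \<bullet> z0)) has_integral 1 - r t) {0..t}"
    by (metis (no_types, lifting) has_integral_eq)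
  with rpos[OF t] show ?thesis by blast
qed

section \<open>Bounds on the game lengths\<close>

lemma capture_time_le: "0 \<le> t \<Longrightarrow> captured (x t) \<Longrightarrow> capture_time x \<le> ennreal t"
  unfolding capture_time_def by (rule Inf_lower) auto

lemma le_capture_time:
  assumes "\<And>t. 0 \<le> t \<Longrightarrow> captured (x t) \<Longrightarrow> c \<le> t"
  shows "ennreal c \<le> capture_time x"
  unfolding capture_time_def by (rule Inf_greatest) (use assms in \<open>auto intro: ennreal_leI\<close>)

text \<open>If pursuer \<open>i\<close> met the straight-running evader at a time \<open>t\<close>
  below the distance \<open>d\<close> to \<open>v\<close>, it would have started within
  \<open>t\<close> of a point at distance \<open>d - t\<close> from \<open>v\<close>, hence no
  farther from \<open>v\<close> than the evader.\<close>

lemma dist_le_game_length: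
  assumes \<sigma>: "admissible \<sigma> g" and v: "v \<in> voronoi_cell g"
  shows "ennreal (dist (fst g) v) \<le> game_length \<sigma> g"
proof (cases "v = fst g")
  case False
  define d where "d = dist (fst g) v"
  define u where "u = (1 / d) *\<^sub>R (v - fst g)"
  have d: "0 < d" using False by (simp add: d_def)
  have u: "norm u = 1" using d by (simp add: u_def d_def dist_norm norm_minus_commute)
  have e: "evader_control (\<lambda>_. u)" using u by (simp add: evader_control_def)
  then obtain x where x: "play \<sigma> g (\<lambda>_. u) x" using \<sigma> by (auto simp: admissible_def)
  have "d \<le> t" if t: "0 \<le> t" "captured (x t)" for t
  proof (rule ccontr)
    assume "\<not> d \<le> t"
    obtain i where i: "snd (x t) i = fst (x t)" using t by (auto simp: captured_def)
    have "((\<lambda>_. u) has_integral (fst (x t) - fst g)) {0..t}" using x t by (simp add: play_def)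
    moreover have "((\<lambda>_. u) has_integral t *\<^sub>R u) {0..t}"
      using has_integral_const_real[of u 0 t] t by simp
    ultimately have E: "fst (x t) = fst g + t *\<^sub>R u"
      using has_integral_unique by (metis add.commute diff_add_cancel)
    have "((\<lambda>s. \<sigma> (x s) u i) has_integral (snd (x t) i - snd g i)) (cbox 0 t)"
      using x t by (simp add: play_def)
    moreover have "norm (\<sigma> (x s) u i) = 1" for s
      using \<sigma> u unfolding admissible_def by blast
    ultimately have "norm (snd (x t) i - snd g i) \<le> 1 * measure lborel (cbox 0 t)"
      by (intro has_integral_bound) auto
    then have "dist (snd g i) (fst (x t)) \<le> t" using t i by (simp add: dist_norm norm_minus_commute)
    moreover have "dist v (fst (x t)) = d - t"
    proof -
      have "v = fst g + d *\<^sub>R u" using d by (simp add: u_def)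
      then have "v - fst (x t) = (d - t) *\<^sub>R u" by (simp add: E algebra_simps)
      then show ?thesis using u \<open>\<not> d \<le> t\<close> by (simp add: dist_norm)
    qed
    moreover have "d < dist v (snd g i)"
      using v by (auto simp: voronoi_cell_def d_def dist_commute)
    ultimately show False using dist_triangle2[of v "snd g i" "fst (x t)"] by simp
  qed
  then have "ennreal d \<le> capture_time x" by (rule le_capture_time)
  also have "\<dots> \<le> game_length \<sigma> g"
    unfolding game_length_def using x by (auto intro!: SUP_upper2)
  finally show ?thesis by (simp add: d_def)
qed simp

text \<open>The points satisfying the bound form a closed set, so the bound extends from the open
  cell to its vertices.\<close>

lemma dist_le_M_C:
  assumes v: "v \<in> closure (voronoi_cell g)"
  shows "ennreal (dist (fst g) v) \<le> M_C g"
proof -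
  have "closed {v. ennreal (dist (fst g) v) \<le> M_C g}"
    by (intro closed_Collect_le continuous_on_ennreal continuous_intros)
  moreover have "voronoi_cell g \<subseteq> {v. ennreal (dist (fst g) v) \<le> M_C g}"
    unfolding M_C_def by (auto intro!: INF_greatest dist_le_game_length)
  ultimately have "closure (voronoi_cell g) \<subseteq> {v. ennreal (dist (fst g) v) \<le> M_C g}"
    by (intro closure_minimal)
  with v show ?thesis by blast
qed

lemma M_C_le_M_D: "M_C g \<le> M_D g"
  unfolding M_C_def M_D_def by (rule INF_lower) (simp add: admissible_D_strategy)

section \<open>Games whose cell is a right isosceles triangle\<close>

text \<open>These take the roles of \<open>V1\<close>, \<open>V2\<close>, \<open>V3\<close>: the
  hypotenuse joins \<open>va\<close> and \<open>vb\<close>, and \<open>labelled_triangle\<close>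
  allows the equal legs.\<close>

abbreviation va :: plane where "va \<equiv> vector [1, 0]"
abbreviation vb :: plane where "vb \<equiv> vector [0, 1]"
abbreviation vc :: plane where "vc \<equiv> vector [0, 0]"
abbreviation T0 :: "plane set" where "T0 \<equiv> convex hull {va, vb, vc}"

lemma not_collinear_triangle:
  fixes p q r :: plane
  assumes "(q $ 1 - p $ 1) * (r $ 2 - p $ 2) \<noteq> (q $ 2 - p $ 2) * (r $ 1 - p $ 1)"
  shows "\<not> collinear {p, q, r}"
proof
  assume "collinear {p, q, r}"
  then obtain u where u: "\<And>x y. x \<in> {p, q, r} \<Longrightarrow> y \<in> {p, q, r} \<Longrightarrow> \<exists>c. x - y = c *\<^sub>R u"
    unfolding collinear_def by blast
  from u[of q p] u[of r p] obtain c d where c: "q - p = c *\<^sub>R u" and d: "r - p = d *\<^sub>R u" by auto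
  have "(q - p) $ 1 * (r - p) $ 2 = (q - p) $ 2 * (r - p) $ 1"
    unfolding c d by simp
  with assms show False by simp
qed

lemma interior_T0: "interior T0 = {x. 0 < x $ 1 \<and> 0 < x $ 2 \<and> x $ 1 + x $ 2 < 1}"
proof -
  have "\<not> collinear {va, vb, vc}" by (rule not_collinear_triangle) simp
  then have *: "interior T0 = {v. \<exists>x y z. 0 < x \<and> 0 < y \<and> 0 < z \<and> x + y + z = 1 \<and>
      x *\<^sub>R va + y *\<^sub>R vb + z *\<^sub>R vc = v}"
    by (rule interior_convex_hull_3_minimal) simp
  show ?thesis
  proof (intro equalityI subsetI)
    fix v :: plane assume "v \<in> {x. 0 < x $ 1 \<and> 0 < x $ 2 \<and> x $ 1 + x $ 2 < 1}"
    then show "v \<in> interior T0"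
      unfolding * mem_Collect_eq
      by (intro exI[of _ "v $ 1"] exI[of _ "v $ 2"] exI[of _ "1 - v $ 1 - v $ 2"])
         (simp add: plane_eq_iff)
  qed (auto simp: *)
qed

lemma closure_interior_T0: "closure (interior T0) = T0"
proof -
  have "vector [1/4, 1/4] \<in> interior T0" by (simp add: interior_T0)
  then have "closure (interior T0) = closure T0"
    by (intro convex_closure_interior) (auto intro: convex_convex_hull)
  then show ?thesis by (simp add: compact_imp_closed compact_convex_hull)
qed

text \<open>The midpoint of the chord \<open>ab\<close> violates the inequality of some pursuer. The difference
  of squared distances is affine, and it is nonnegative at \<open>a\<close> and \<open>b\<close>, so it vanishes there.\<close>

lemma bisector_through_edge:
  assumes a: "a \<in> closure (voronoi_cell g)" and b: "b \<in> closure (voronoi_cell g)"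
    and m: "midpoint a b \<notin> voronoi_cell g"
  shows "\<exists>i. dist a (snd g i) = dist a (fst g) \<and> dist b (snd g i) = dist b (fst g)"
proof -
  define E where "E = fst g"
  from m obtain i where i: "dist (midpoint a b) (snd g i) \<le> dist (midpoint a b) E"
    by (auto simp: voronoi_cell_def E_def not_less)
  define P where "P = snd g i"
  define h where "h v = (dist v P)\<^sup>2 - (dist v E)\<^sup>2" for v
  have h: "h v = 2 * (v \<bullet> (E - P)) + P \<bullet> P - E \<bullet> E" for v
    by (simp add: h_def dist_norm power2_norm_eq_inner inner_diff_left inner_diff_right
        inner_commute algebra_simps)
  have "h a + h b = 2 * h (midpoint a b)"
    by (simp add: h midpoint_def inner_add_left inner_diff_right field_simps)
  also have "\<dots> \<le> 0"
    using i by (simp add: h_def P_def)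
  finally have "h a + h b \<le> 0" .
  moreover have "0 \<le> h v" if "v \<in> closure (voronoi_cell g)" for v
  proof -
    have "closed {v. dist v E \<le> dist v P}" by (intro closed_Collect_le continuous_intros)
    moreover have "voronoi_cell g \<subseteq> {v. dist v E \<le> dist v P}"
      by (auto simp: voronoi_cell_def E_def P_def less_imp_le)
    ultimately have "closure (voronoi_cell g) \<subseteq> {v. dist v E \<le> dist v P}"
      by (rule closure_minimal[rotated])
    then show ?thesis using that by (auto simp: h_def power_mono)
  qed
  ultimately have "h a = 0" "h b = 0" using a b by (meson add_nonneg_eq_0_iff antisym add_nonneg_nonneg)+
  then show ?thesis by (auto simp: h_def E_def P_def)
qed

text \<open>A pursuer starting at the evader would make the cell empty. Otherwise the evader belongs
  to its own cell.\<close>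

lemma T0_game_evader:
  assumes cell: "voronoi_cell g = interior T0"
  shows "fst g \<in> interior T0" and "snd g i \<noteq> fst g"
proof -
  have "vector [1/4, 1/4] \<in> voronoi_cell g" by (simp add: cell interior_T0)
  then have *: "snd g i \<noteq> fst g" for i
    unfolding voronoi_cell_def by (metis (mono_tags) less_irrefl mem_Collect_eq)
  then show "snd g i \<noteq> fst g" .
  have "fst g \<in> voronoi_cell g" using * by (force simp: voronoi_cell_def)
  then show "fst g \<in> interior T0" by (simp add: cell)
qed

lemma T0_game_edge:
  assumes cell: "voronoi_cell g = interior T0"
    and "p \<in> {va, vb, vc}" "q \<in> {va, vb, vc}" and "midpoint p q \<notin> interior T0"
  obtains i where "(snd g i $ 1 - p $ 1)\<^sup>2 + (snd g i $ 2 - p $ 2)\<^sup>2 =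
      (fst g $ 1 - p $ 1)\<^sup>2 + (fst g $ 2 - p $ 2)\<^sup>2"
    and "(snd g i $ 1 - q $ 1)\<^sup>2 + (snd g i $ 2 - q $ 2)\<^sup>2 =
      (fst g $ 1 - q $ 1)\<^sup>2 + (fst g $ 2 - q $ 2)\<^sup>2"
proof -
  have "p \<in> closure (voronoi_cell g)" "q \<in> closure (voronoi_cell g)"
    using assms(2,3) hull_inc unfolding cell closure_interior_T0 by metis+
  from bisector_through_edge[OF this] assms(4) cell
  obtain i where "dist p (snd g i) = dist p (fst g)" "dist q (snd g i) = dist q (fst g)"
    by auto
  then show thesis
    by (intro that[of i]) (simp_all add: dist_norm norm_plane power2_commute)
qed

text \<open>Being as far from both ends of an edge as the evader leaves only the evader itself and
  its mirror image in that edge, and the former is excluded. Thus the cell and the evader position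
  determine where the relevant pursuers are.\<close>

lemma T0_game_pursuers:
  assumes cell: "voronoi_cell g = interior T0"
  defines "a \<equiv> fst g $ 1" and "b \<equiv> fst g $ 2"
  obtains i j k where "snd g i - fst g = vector [- 2 * a, 0]"
    and "snd g j - fst g = vector [0, - 2 * b]"
    and "snd g k - fst g = vector [1 - a - b, 1 - a - b]"
proof -
  have ne: "snd g i $ 1 \<noteq> a \<or> snd g i $ 2 \<noteq> b" for i
    using T0_game_evader(2)[OF cell, of i] by (auto simp: a_def b_def plane_eq_iff)
  note edge = T0_game_edge[OF cell, folded a_def b_def]
  have mid: "midpoint vb vc \<notin> interior T0" "midpoint va vc \<notin> interior T0"
    "midpoint va vb \<notin> interior T0"
    by (auto simp: interior_T0 midpoint_def)
  from edge[OF _ _ mid(1)] obtain i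
    where i: "(snd g i $ 1)\<^sup>2 + (snd g i $ 2 - 1)\<^sup>2 = a\<^sup>2 + (b - 1)\<^sup>2"
      "(snd g i $ 1)\<^sup>2 + (snd g i $ 2)\<^sup>2 = a\<^sup>2 + b\<^sup>2" by auto
  then have "snd g i $ 2 = b" by (simp add: power2_diff)
  with i(2) have "snd g i $ 1 = a \<or> snd g i $ 1 = - a" by (simp add: power2_eq_iff)
  with \<open>snd g i $ 2 = b\<close> ne[of i] have i': "snd g i - fst g = vector [- 2 * a, 0]"
    by (auto simp: plane_eq_iff a_def b_def)
  from edge[OF _ _ mid(2)] obtain j
    where j: "(snd g j $ 1 - 1)\<^sup>2 + (snd g j $ 2)\<^sup>2 = (a - 1)\<^sup>2 + b\<^sup>2"
      "(snd g j $ 1)\<^sup>2 + (snd g j $ 2)\<^sup>2 = a\<^sup>2 + b\<^sup>2" by auto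
  then have "snd g j $ 1 = a" by (simp add: power2_diff)
  with j(2) have "snd g j $ 2 = b \<or> snd g j $ 2 = - b" by (simp add: power2_eq_iff)
  with \<open>snd g j $ 1 = a\<close> ne[of j] have j': "snd g j - fst g = vector [0, - 2 * b]"
    by (auto simp: plane_eq_iff a_def b_def)
  from edge[OF _ _ mid(3)] obtain k
    where k: "(snd g k $ 1 - 1)\<^sup>2 + (snd g k $ 2)\<^sup>2 = (a - 1)\<^sup>2 + b\<^sup>2"
      "(snd g k $ 1)\<^sup>2 + (snd g k $ 2 - 1)\<^sup>2 = a\<^sup>2 + (b - 1)\<^sup>2" by auto
  \<comment> \<open>The bisector is the hypotenuse, so the offset is diagonal, with both coordinates
    equal to \<open>t\<close>.\<close>
  define t where "t = snd g k $ 1 - a"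
  from k have "snd g k $ 2 - snd g k $ 1 = b - a" by (simp add: power2_diff)
  then have t: "snd g k $ 1 = a + t" "snd g k $ 2 = b + t" by (auto simp: t_def)
  have "t \<noteq> 0" using ne[of k] t by auto
  moreover have "2 * t * (t - (1 - a - b)) = 0"
    using k(1) unfolding t by (simp add: power2_eq_square algebra_simps)
  ultimately have "t = 1 - a - b" by simp
  then have k': "snd g k - fst g = vector [1 - a - b, 1 - a - b]"
    using t by (simp add: plane_eq_iff a_def b_def)
  from that[OF i' j' k'] show thesis .
qed

text \<open>The three summands are \<open>max 0 (n \<bullet> u)\<close> for the outer normals \<open>n\<close> scaled to the edge lengths,
  and \<open>1 / sqrt 2\<close> is the smallest height.\<close>

lemma T0_consumption_rate:
  fixes u :: plane
  assumes "norm u = 1"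
  shows "1 / sqrt 2 \<le> max 0 (- (u $ 1)) + max 0 (- (u $ 2)) + max 0 (u $ 1 + u $ 2)" (is "_ \<le> ?M")
proof -
  \<comment> \<open>A positive coordinate is \<open>u $ 1 + u $ 2\<close> plus the negative of the
    other one.\<close>
  have "\<bar>u $ 1\<bar> \<le> ?M" "\<bar>u $ 2\<bar> \<le> ?M" and M: "0 \<le> ?M" by linarith+
  then have "(u $ 1)\<^sup>2 \<le> ?M\<^sup>2" "(u $ 2)\<^sup>2 \<le> ?M\<^sup>2"
    by (simp_all only: abs_le_square_iff[symmetric] abs_of_nonneg)
  moreover have "(u $ 1)\<^sup>2 + (u $ 2)\<^sup>2 = 1" using assms by (simp add: norm_plane)
  ultimately have "1 / 2 \<le> ?M\<^sup>2" by simp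
  then have "sqrt (1 / 2) \<le> ?M" using M real_le_lsqrt real_sqrt_le_mono real_sqrt_unique by metis
  then show ?thesis by (simp add: real_sqrt_divide)
qed

lemma T0_M_D_le:
  assumes cell: "voronoi_cell g = interior T0"
  shows "M_D g \<le> ennreal (sqrt 2)"
  unfolding M_D_def game_length_def
proof (rule SUP_least, clarify)
  fix e x assume play: "play D_strategy g e x"
  then have e: "evader_control e" by (simp add: play_def)
  have "\<exists>t\<in>{0..sqrt 2}. captured (x t)"
  proof (rule ccontr)
    assume "\<not> (\<exists>t\<in>{0..sqrt 2}. captured (x t))"
    then have free: "\<And>i t. t \<in> {0..sqrt 2} \<Longrightarrow> snd (x t) i \<noteq> fst (x t)"
      by (auto simp: captured_def)
    \<comment> \<open>The distances to the two legs and the hypotenuse, each times the length of its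
      edge; their sum 1 is twice the area.\<close>
    define a b c where "a = fst g $ 1" and "b = fst g $ 2" and "c = 1 - a - b"
    have pos: "0 < a" "0 < b" "0 < c"
      using T0_game_evader(1)[OF cell] by (auto simp: interior_T0 a_def b_def c_def)
    obtain i j k where z: "snd g i - fst g = vector [- 2 * a, 0]"
      "snd g j - fst g = vector [0, - 2 * b]" "snd g k - fst g = vector [c, c]"
      using T0_game_pursuers[OF cell] unfolding a_def b_def c_def by metis
    have "sqrt 2 \<in> {0..sqrt 2}" by simp
    note offset = D_play_offset[OF play free this]
    from offset[of i] obtain r1 where r1: "0 < r1"
      "((\<lambda>s. max 0 (- 2 * a * e s $ 1) / (2 * a * a)) has_integral 1 - r1) {0..sqrt 2}"
      unfolding z by (auto simp: inner_plane mult.assoc)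
    from offset[of j] obtain r2 where r2: "0 < r2"
      "((\<lambda>s. max 0 (- 2 * b * e s $ 2) / (2 * b * b)) has_integral 1 - r2) {0..sqrt 2}"
      unfolding z by (auto simp: inner_plane mult.assoc)
    from offset[of k] obtain r3 where r3: "0 < r3"
      "((\<lambda>s. max 0 (c * e s $ 1 + c * e s $ 2) / (c * c)) has_integral 1 - r3) {0..sqrt 2}"
      unfolding z by (auto simp: inner_plane)
    \<comment> \<open>Multiplication by the weighted distance turns the relative shrinking rate into
      an absolute one.\<close>
    have m: "a * (max 0 (- 2 * a * y) / (2 * a * a)) = max 0 (- y)" if "0 < a" for a y :: real
      using that by (auto simp: max_def mult_le_0_iff zero_le_mult_iff)
    have m': "c * (max 0 (c * y + c * z) / (c * c)) = max 0 (y + z)" if "0 < c" for c y z :: real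
      using that by (auto simp: max_def zero_le_mult_iff simp flip: distrib_left)
    have "((\<lambda>s. a * (max 0 (- 2 * a * e s $ 1) / (2 * a * a))
        + b * (max 0 (- 2 * b * e s $ 2) / (2 * b * b))
        + c * (max 0 (c * e s $ 1 + c * e s $ 2) / (c * c))) has_integral
        a * (1 - r1) + b * (1 - r2) + c * (1 - r3)) {0..sqrt 2}"
      by (intro has_integral_add has_integral_mult_right r1 r2 r3)
    then have "((\<lambda>s. max 0 (- (e s $ 1)) + max 0 (- (e s $ 2)) + max 0 (e s $ 1 + e s $ 2))
        has_integral
        a * (1 - r1) + b * (1 - r2) + c * (1 - r3)) {0..sqrt 2}"
      unfolding m[OF pos(1)] m[OF pos(2)] m'[OF pos(3)] .
    moreover have "((\<lambda>s. 1 / sqrt 2) has_integral 1) {0..sqrt 2}"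
      using has_integral_const_real[of "1 / sqrt 2" 0 "sqrt 2"] by simp
    \<comment> \<open>A rate of at least \<open>1 / sqrt 2\<close> over time \<open>sqrt 2\<close>
      consumes the whole budget 1, although the fractions \<open>r1\<close>, \<open>r2\<close>,
      \<open>r3\<close> left are positive.\<close>
    ultimately have "1 \<le> a * (1 - r1) + b * (1 - r2) + c * (1 - r3)"
      using T0_consumption_rate[OF norm_evader[OF e]] by (meson has_integral_le)
    also have "\<dots> = 1 - (a * r1 + b * r2 + c * r3)"
      by (simp add: c_def algebra_simps)
    finally show False using pos r1(1) r2(1) r3(1)
      by (smt (verit) mult_pos_pos)
  qed
  then obtain t where t: "0 \<le> t" "t \<le> sqrt 2" "captured (x t)" by auto
  then show "capture_time x \<le> ennreal (sqrt 2)"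
    using capture_time_le[of t x] ennreal_leI[OF t(2)] order_trans by blast
qed

text \<open>The line through \<open>E\<close> parallel to the hypotenuse meets the legs at
  \<open>(0, c)\<close> and \<open>(c, 0)\<close>, where \<open>c\<close> is the coordinate sum of
  \<open>E\<close>. As \<open>E\<close> tends to \<open>va\<close>, \<open>c\<close> tends to 1 and
  only the length of the hypotenuse remains.\<close>

lemma T0_D_formula:
  assumes "E \<in> interior T0"
  shows "D_formula va vb vc E = (E $ 1 + E $ 2) * sqrt 2 + (1 - (E $ 1 + E $ 2))"
proof -
  define c where "c = E $ 1 + E $ 2"
  from assms have pos: "0 < E $ 1" "0 < E $ 2" "c < 1" by (auto simp: interior_T0 c_def)
  have S: "closed_segment vb vc \<inter> line_dir E (va - vb) = {vector [0, c]}"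
  proof (intro equalityI subsetI)
    fix y assume "y \<in> {vector [0, c] :: plane}"
    then have y: "y = vector [0, c]" by simp
    have "y = (1 - (1 - c)) *\<^sub>R vb + (1 - c) *\<^sub>R vc" "y = E + (- E $ 1) *\<^sub>R (va - vb)"
      by (simp_all add: y plane_eq_iff c_def)
    then show "y \<in> closed_segment vb vc \<inter> line_dir E (va - vb)"
      unfolding closed_segment_def line_dir_def using pos c_def
      by (intro IntI CollectI exI[of _ "1 - c"] exI[of _ "- E $ 1"]) auto
  qed (auto simp: closed_segment_def line_dir_def plane_eq_iff c_def)
  have Q: "closed_segment va vc \<inter> line_dir E (va - vb) = {vector [c, 0]}"
  proof (intro equalityI subsetI)
    fix y assume "y \<in> {vector [c, 0] :: plane}"
    then have y: "y = vector [c, 0]" by simp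
    have "y = (1 - (1 - c)) *\<^sub>R va + (1 - c) *\<^sub>R vc" "y = E + E $ 2 *\<^sub>R (va - vb)"
      by (simp_all add: y plane_eq_iff c_def)
    then show "y \<in> closed_segment va vc \<inter> line_dir E (va - vb)"
      unfolding closed_segment_def line_dir_def using pos c_def
      by (intro IntI CollectI exI[of _ "1 - c"] exI[of _ "E $ 2"]) auto
  qed (auto simp: closed_segment_def line_dir_def plane_eq_iff c_def)
  have "norm (vector [0, c] - vector [c, 0] :: plane) = sqrt (c\<^sup>2 * 2)"
    by (simp add: norm_plane)
  also have "\<dots> = c * sqrt 2" using pos(1,2) by (simp add: real_sqrt_mult c_def)
  finally have "norm (vector [0, c] - vector [c, 0] :: plane) = c * sqrt 2" .
  moreover have "norm (vector [c, 0] - va) = 1 - c"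
    using pos by (simp add: norm_plane)
  ultimately show ?thesis by (simp add: D_formula_def S Q c_def)
qed

text \<open>Placing the pursuers at the mirror images of \<open>E\<close> in the three edges makes
  each edge a bisector.\<close>

lemma T0_game_exists:
  assumes E: "E \<in> interior T0"
  shows "\<exists>g. three_pursuer_game g \<and> voronoi_cell g = interior T0 \<and> fst g = E"
proof -
  define a b c where "a = E $ 1" and "b = E $ 2" and "c = 1 - a - b"
  from E have pos: "0 < a" "0 < b" "0 < c" by (auto simp: interior_T0 a_def b_def c_def)
  \<comment> \<open>The mirror images in the edges \<open>vb vc\<close>, \<open>va vc\<close> and
    \<open>va vb\<close>.\<close>
  define p q r :: plane where "p = vector [- a, b]" and "q = vector [a, - b]"
    and "r = vector [1 - b, 1 - a]"
  define g :: state where "g = (E, \<lambda>i. if i = 1 then p else if i = 2 then q else r)"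
  have all: "(\<forall>i. R (snd g i)) \<longleftrightarrow> R p \<and> R q \<and> R r" for R
    by (auto simp: g_def forall_3)
  have fst_g: "fst g = E" by (simp add: g_def)
  have "y \<in> range (snd g) \<longleftrightarrow> y \<in> {p, q, r}" for y
    using all[of "\<lambda>x. y \<noteq> x"] by blast
  then have "range (snd g) = {p, q, r}" by blast
  moreover have "\<not> collinear {p, q, r}"
  proof (rule not_collinear_triangle)
    \<comment> \<open>This is half the difference of the two sides below.\<close>
    have "0 < a * c + b * c + 2 * a * b" using pos by (intro add_pos_pos mult_pos_pos) auto
    then show "(q $ 1 - p $ 1) * (r $ 2 - p $ 2) \<noteq> (q $ 2 - p $ 2) * (r $ 1 - p $ 1)"
      by (simp add: p_def q_def r_def c_def algebra_simps)
  qed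
  moreover have "\<exists>x y z. 0 < x \<and> 0 < y \<and> 0 < z \<and> x + y + z = 1 \<and> x *\<^sub>R p + y *\<^sub>R q + z *\<^sub>R r = E"
  proof -
    \<comment> \<open>The weights \<open>b * c\<close>, \<open>a * c\<close>,
      \<open>2 * a * b\<close> make the offsets \<open>(- 2 * a, 0)\<close>,
      \<open>(0, - 2 * b)\<close>, \<open>(c, c)\<close> from \<open>E\<close> cancel;
      \<open>d\<close> normalises them.\<close>
    define d where "d = b * c + a * c + 2 * a * b"
    have d: "0 < d" using pos by (simp add: d_def add_pos_pos)
    have "b * c / d + a * c / d + 2 * a * b / d = 1"
      using d by (simp add: d_def flip: add_divide_distrib)
    moreover have "(b * c / d) *\<^sub>R p + (a * c / d) *\<^sub>R q + (2 * a * b / d) *\<^sub>R r = E"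
    proof -
      have "(b * c) *\<^sub>R p + (a * c) *\<^sub>R q + (2 * a * b) *\<^sub>R r = d *\<^sub>R E"
        by (simp add: plane_eq_iff p_def q_def r_def d_def c_def flip: a_def b_def)
           (simp add: algebra_simps)
      then have "(1 / d) *\<^sub>R ((b * c) *\<^sub>R p + (a * c) *\<^sub>R q + (2 * a * b) *\<^sub>R r) = E"
        using d by simp
      then show ?thesis by (simp add: scaleR_add_right)
    qed
    ultimately show ?thesis using pos d
      by (intro exI[of _ "b * c / d"] exI[of _ "a * c / d"] exI[of _ "2 * a * b / d"]) auto
  qed
  ultimately have "three_pursuer_game g"
    unfolding three_pursuer_game_def by (simp add: interior_convex_hull_3_minimal fst_g)
  moreover have "voronoi_cell g = interior T0"
  proof -
    have "dist v E < dist v p \<longleftrightarrow> 0 < 4 * a * v $ 1" for v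
      by (simp add: dist_norm norm_plane p_def a_def b_def power2_eq_square algebra_simps)
    moreover have "dist v E < dist v q \<longleftrightarrow> 0 < 4 * b * v $ 2" for v
      by (simp add: dist_norm norm_plane q_def a_def b_def power2_eq_square algebra_simps)
    moreover have "dist v E < dist v r \<longleftrightarrow> 0 < 2 * c * (1 - (v $ 1 + v $ 2))" for v
      by (simp add: dist_norm norm_plane r_def a_def b_def c_def power2_eq_square algebra_simps)
    ultimately have "(\<forall>i. dist v (fst g) < dist v (snd g i)) \<longleftrightarrow> v \<in> interior T0" for v
      using pos all[of "\<lambda>x. dist v E < dist v x"] fst_g
      by (simp add: interior_T0 zero_less_mult_iff)
    then show ?thesis by (auto simp: voronoi_cell_def)
  qed
  ultimately show ?thesis using fst_g by blast
qed

section \<open>The limit\<close>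

lemma eventually_games_near:
  "eventually R (games_near V1 V2 V3 X) \<longleftrightarrow> (\<exists>\<delta>>0. \<forall>g. three_pursuer_game g \<and>
     voronoi_cell g = interior (convex hull {V1, V2, V3}) \<and> dist (fst g) X < \<delta> \<longrightarrow> R g)"
  unfolding games_near_def
proof (subst eventually_INF_base)
  let ?G = "\<lambda>\<delta>. principal {g. three_pursuer_game g \<and>
        voronoi_cell g = interior (convex hull {V1, V2, V3}) \<and> dist (fst g) X < \<delta>}"
  show "\<exists>x\<in>{0<..}. ?G x \<le> inf (?G a) (?G b)"
    if "a \<in> {0<..}" "b \<in> {0<..}" for a b :: real
    using that by (intro bexI[of _ "min a b"]) auto
qed (auto simp: eventually_principal)

lemma tendsto_fst_games_near: "(fst \<longlongrightarrow> X) (games_near V1 V2 V3 X)"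
  by (rule tendstoI) (auto simp: eventually_games_near)

lemma eventually_T0_cell:
  "eventually (\<lambda>g. voronoi_cell g = interior T0) (games_near va vb vc X)"
  unfolding eventually_games_near by (auto intro: exI[of _ 1])

text \<open>The vertex \<open>va\<close> is a limit of interior points of the triangle, and each of
  those is the evader position of a game with this cell.\<close>

lemma T0_games_near_not_bot: "games_near va vb vc va \<noteq> bot"
proof
  assume "games_near va vb vc va = bot"
  then have "eventually (\<lambda>_. False) (games_near va vb vc va)" by simp
  then obtain \<delta> where \<delta>: "0 < \<delta>" and none: "\<And>g. three_pursuer_game g \<Longrightarrow>
      voronoi_cell g = interior T0 \<Longrightarrow> \<not> dist (fst g) va < \<delta>"
    unfolding eventually_games_near by blast
  have "va \<in> closure (interior T0)" by (simp add: closure_interior_T0 hull_inc)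
  then obtain E where E: "E \<in> interior T0" "dist E va < \<delta>"
    using \<delta> unfolding closure_approachable by blast
  with T0_game_exists[OF E(1)] none show False by blast
qed

text \<open>The evader start is a boundary point of the cell, so the equality is read through the
  limit convention. Excluding \<open>bot\<close> keeps the limits from being vacuous, and
  \<open>D_formula\<close> ties the limit of \<open>M_D\<close> to the closed form.\<close>

theorem theorem4:
  shows "\<exists>V1 V2 V3 X (L::real).
           labelled_triangle V1 V2 V3 \<and> X \<in> frontier (convex hull {V1, V2, V3}) \<and> 0 < L \<and>
           games_near V1 V2 V3 X \<noteq> bot \<and>
           (M_C \<longlongrightarrow> ennreal L) (games_near V1 V2 V3 X) \<and>
           (M_D \<longlongrightarrow> ennreal L) (games_near V1 V2 V3 X) \<and>
           ((\<lambda>g. D_formula V1 V2 V3 (fst g)) \<longlongrightarrow> L) (games_near V1 V2 V3 X)"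
proof (intro exI conjI)
  let ?F = "games_near va vb vc va"
  show "labelled_triangle va vb vc"
    unfolding labelled_triangle_def
    by (auto simp: dist_norm norm_plane intro!: not_collinear_triangle)
  have "va \<in> T0" by (simp add: hull_inc)
  moreover have "va \<notin> interior T0" by (simp add: interior_T0)
  ultimately show "va \<in> frontier T0"
    unfolding frontier_def using closure_subset by blast
  show "0 < sqrt (2::real)" by simp
  show "?F \<noteq> bot" by (rule T0_games_near_not_bot)
  \<comment> \<open>The squeeze is
    \<open>dist (fst g) vb \<le> M_C g \<le> M_D g \<le> sqrt 2\<close>, whose left end tends to the
    length of the hypotenuse.\<close>
  have lower: "eventually (\<lambda>g. ennreal (dist (fst g) vb) \<le> M_C g) ?F"
    using eventually_T0_cell
    by eventually_elim (simp add: dist_le_M_C closure_interior_T0 hull_inc)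
  have upper: "eventually (\<lambda>g. M_D g \<le> ennreal (sqrt 2)) ?F"
    using eventually_T0_cell by eventually_elim (rule T0_M_D_le)
  have "((\<lambda>g. ennreal (dist (fst g) vb)) \<longlongrightarrow> ennreal (dist va vb)) ?F"
    by (intro tendsto_ennrealI tendsto_dist tendsto_fst_games_near tendsto_const)
  also have "dist va vb = sqrt 2" by (simp add: dist_norm norm_plane)
  finally have lim: "((\<lambda>g. ennreal (dist (fst g) vb)) \<longlongrightarrow> ennreal (sqrt 2)) ?F" .
  show "(M_C \<longlongrightarrow> ennreal (sqrt 2)) ?F"
    using lower _ lim tendsto_const
  proof (rule tendsto_sandwich)
    show "eventually (\<lambda>g. M_C g \<le> ennreal (sqrt 2)) ?F"
      using upper by eventually_elim (rule order_trans[OF M_C_le_M_D])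
  qed
  show "(M_D \<longlongrightarrow> ennreal (sqrt 2)) ?F"
    using _ upper lim tendsto_const
  proof (rule tendsto_sandwich)
    show "eventually (\<lambda>g. ennreal (dist (fst g) vb) \<le> M_D g) ?F"
      using lower by eventually_elim (rule order_trans[OF _ M_C_le_M_D])
  qed
  have "((\<lambda>g. (fst g $ 1 + fst g $ 2) * sqrt 2 + (1 - (fst g $ 1 + fst g $ 2))) \<longlongrightarrow>
      (va $ 1 + va $ 2) * sqrt 2 + (1 - (va $ 1 + va $ 2))) ?F"
    by (intro tendsto_intros tendsto_fst_games_near)
  moreover have "eventually (\<lambda>g. (fst g $ 1 + fst g $ 2) * sqrt 2 + (1 - (fst g $ 1 + fst g $ 2)) =
      D_formula va vb vc (fst g)) ?F"
    using eventually_T0_cell by eventually_elim (simp add: T0_D_formula T0_game_evader(1))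
  ultimately show "((\<lambda>g. D_formula va vb vc (fst g)) \<longlongrightarrow> sqrt 2) ?F"
    by (simp add: tendsto_cong)
qed

end
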